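(* Let $\mathbf{u}$ be a periodic vector grid function on the face-centered grid $\mathbb{F}$ that is discretely divergence-free, $\mathbf{D}^h\cdot\mathbf{u}=0$, and let $\mathbf{u}_0=\frac{1}{V}\sum_{\mathbf{x}\in\mathbb{F}}\mathbf{u}(\mathbf{x})h^3\in\mathbb{R}^3$ be its mean. Let $\mathbf{a}$ be a periodic vector grid function on the edge-centered grid $\mathbb{E}$ satisfying $$\mathbf{D}^h\times\mathbf{a}=\mathbf{u}-\mathbf{u}_0,\qquad \mathbf{D}^h\cdot\mathbf{a}=0 .$$ Let the regularized delta function $\delta_h$ be of class $C^k$ with $k\ge 1$, and define the interpolated velocity field $$\boldsymbol{U}(\boldsymbol{X})=\mathbf{u}_0+\sum_{\mathbf{x}\in\mathbb{E}}\mathbf{a}(\mathbf{x})\times(\nabla\delta_h)(\mathbf{x}-\boldsymbol{X})\,h^3$$ for every $\boldsymbol{X}$ in the periodic domain $\Omega$. Then $\boldsymbol{U}$ is a globally defined function of class $C^{k-1}$ on $\Omega$, and if $k\ge 2$ it is continuously divergence-free, i.e. $(\nabla\cdot\boldsymbol{U})(\boldsymbol{X})=0$ for all $\boldsymbol{X}\in\Omega$.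
   Context: Let $\Omega=[0,L]^3$ with periodic boundary conditions, $N$ a positive integer, $h=L/N$. All indices $i,j,k$ below are taken modulo $N$, and all grid functions are real-valued and periodic. Staggered grids. Cell-centered grid $\mathbb{C}$: points $((i+\frac12)h,(j+\frac12)h,(k+\frac12)h)$. Node-centered grid $\mathbb{N}$: points $(ih,jh,kh)$. A vector grid function on the face-centered grid $\mathbb{F}$ has its component $\alpha\in\{1,2,3\}$ defined on the cell-centered grid shifted by $-\frac h2\mathbf{e}_\alpha$. A vector grid function on the edge-centered grid $\mathbb{E}$ has its component $\alpha$ defined on the node-centered grid shifted by $+\frac h2\mathbf{e}_\alpha$. Here $\mathbf{e}_1,\mathbf{e}_2,\mathbf{e}_3$ is the standard basis of $\mathbb{R}^3$. Difference operators. $D^h_\alpha\varphi(\mathbf{x})=\frac{1}{h}\left(\varphi(\mathbf{x}+\frac h2\mathbf{e}_\alpha)-\varphi(\mathbf{x}-\frac h2\mathbf{e}_\alpha)\right)$; $\mathbf{D}^h\cdot\mathbf{v}=\sum_\alpha D^h_\alpha v_\alpha$ (maps functions on $\mathbb{F}$ to $\mathbb{C}$, and on $\mathbb{E}$ to $\mathbb{N}$); $(\mathbf{D}^h\times\mathbf{v})_i=\sum_{j,k}\epsilon_{ijk}D^h_jv_k$ (maps $\mathbb{E}$ to $\mathbb{F}$ and $\mathbb{F}$ to $\mathbb{E}$). Sums of vector-valued expressions over $\mathbf{x}\in\mathbb{F}$ or $\mathbf{x}\in\mathbb{E}$ are understood with each component of the grid function summed over its own subgrid; for instance the $i$-th component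 of $\sum_{\mathbf{x}\in\mathbb{E}}\mathbf{a}(\mathbf{x})\times(\nabla\delta_h)(\mathbf{x}-\boldsymbol{X})h^3$ is $\sum_{j,k}\epsilon_{ijk}\sum_{\mathbf{x}}a_j(\mathbf{x})(\partial_k\delta_h)(\mathbf{x}-\boldsymbol{X})h^3$ with $\mathbf{x}$ running over the subgrid carrying $a_j$. $V=L^3$ is the volume of the domain. Regularized delta function: $\delta_h(\mathbf{x})=\frac1{h^3}\phi(\frac{x_1}h)\phi(\frac{x_2}h)\phi(\frac{x_3}h)$, where $\phi:\mathbb{R}\to\mathbb{R}$ is a compactly supported kernel; on the periodic domain $\delta_h$ is extended periodically, i.e. replaced by $\sum_{\mathbf{n}\in\mathbb{Z}^3}\delta_h(\cdot+L\mathbf{n})$. *)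

theory Defs
  imports "HOL-Analysis.Analysis"
begin

definition levi_civita :: "3 \<Rightarrow> 3 \<Rightarrow> 3 \<Rightarrow> real" where
  "levi_civita i j k =
     (if (i, j, k) \<in> {(1, 2, 3), (2, 3, 1), (3, 1, 2)} then 1
      else if (i, j, k) \<in> {(1, 3, 2), (3, 2, 1), (2, 1, 3)} then -1
      else 0)"

(* The periodic domain is R^3 modulo L Z^3: functions on it are L-periodic functions on R^3, and
   sums over a periodic grid run over the grid points in the half-open box [0, L)^3. *)

definition periodic_box :: "real \<Rightarrow> (real^3) set" where
  "periodic_box L = {x. \<forall>i. 0 \<le> x $ i \<and> x $ i < L}"

definition periodic_on :: "real \<Rightarrow> (real^3) set \<Rightarrow> (real^3 \<Rightarrow> 'b) \<Rightarrow> bool" where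
  "periodic_on L S f \<longleftrightarrow> (\<forall>x\<in>S. \<forall>i. f (x + L *\<^sub>R axis i 1) = f x)"

definition cell_grid :: "real \<Rightarrow> (real^3) set" where
  "cell_grid h = range (\<lambda>n :: int^3. \<chi> i. (of_int (n $ i) + 1/2) * h)"

definition node_grid :: "real \<Rightarrow> (real^3) set" where
  "node_grid h = range (\<lambda>n :: int^3. \<chi> i. of_int (n $ i) * h)"

definition face_grid :: "real \<Rightarrow> 3 \<Rightarrow> (real^3) set" where
  "face_grid h \<alpha> = (\<lambda>x. x - (h/2) *\<^sub>R axis \<alpha> 1) ` cell_grid h"

definition edge_grid :: "real \<Rightarrow> 3 \<Rightarrow> (real^3) set" where
  "edge_grid h \<alpha> = (\<lambda>x. x + (h/2) *\<^sub>R axis \<alpha> 1) ` node_grid h"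

(* A vector grid function is given by its three components; since each component lives on its own
   subgrid, only the values of component \<alpha> on face_grid h \<alpha> (or edge_grid h \<alpha>) are
   meaningful. *)

type_synonym vector_grid_fun = "3 \<Rightarrow> real^3 \<Rightarrow> real"

definition grid_diff :: "real \<Rightarrow> 3 \<Rightarrow> (real^3 \<Rightarrow> real) \<Rightarrow> real^3 \<Rightarrow> real" where
  "grid_diff h \<alpha> \<phi> x =
     (\<phi> (x + (h/2) *\<^sub>R axis \<alpha> 1) - \<phi> (x - (h/2) *\<^sub>R axis \<alpha> 1)) / h"

definition grid_div :: "real \<Rightarrow> vector_grid_fun \<Rightarrow> real^3 \<Rightarrow> real" where
  "grid_div h v x = (\<Sum>\<alpha>\<in>UNIV. grid_diff h \<alpha> (v \<alpha>) x)"

definition grid_curl :: "real \<Rightarrow> vector_grid_fun \<Rightarrow> vector_grid_fun" where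
  "grid_curl h v i x = (\<Sum>j\<in>UNIV. \<Sum>k\<in>UNIV. levi_civita i j k * grid_diff h j (v k) x)"

definition face_mean :: "real \<Rightarrow> real \<Rightarrow> vector_grid_fun \<Rightarrow> real^3" where
  "face_mean L h u =
     (\<chi> \<alpha>. 1 / L^3 * (\<Sum>x \<in> face_grid h \<alpha> \<inter> periodic_box L. u \<alpha> x * h^3))"

definition compactly_supported :: "(real \<Rightarrow> real) \<Rightarrow> bool" where
  "compactly_supported \<phi> \<longleftrightarrow> compact (closure (support_on UNIV \<phi>))"

definition delta :: "real \<Rightarrow> (real \<Rightarrow> real) \<Rightarrow> real^3 \<Rightarrow> real" where
  "delta h \<phi> x = 1 / h^3 * (\<phi> (x $ 1 / h) * \<phi> (x $ 2 / h) * \<phi> (x $ 3 / h))"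

(* For compactly supported \<phi> only finitely many terms of this sum are nonzero. *)
definition periodic_delta :: "real \<Rightarrow> real \<Rightarrow> (real \<Rightarrow> real) \<Rightarrow> real^3 \<Rightarrow> real" where
  "periodic_delta L h \<phi> x =
     (\<Sum>\<^sub>\<infinity>n \<in> (UNIV :: (int^3) set). delta h \<phi> (x + L *\<^sub>R (\<chi> i. of_int (n $ i))))"

definition partial_deriv :: "3 \<Rightarrow> (real^3 \<Rightarrow> real) \<Rightarrow> real^3 \<Rightarrow> real" where
  "partial_deriv i f x = deriv (\<lambda>t. f (x + t *\<^sub>R axis i 1)) 0"

definition divergence :: "(real^3 \<Rightarrow> real^3) \<Rightarrow> real^3 \<Rightarrow> real" where
  "divergence F x = (\<Sum>i\<in>UNIV. partial_deriv i (\<lambda>y. F y $ i) x)"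

(* f is of class C^k on the whole space: all iterated directional derivatives up to order k - 1
   are differentiable, and those of order k are continuous. *)
primrec C_k :: "nat \<Rightarrow> ('a::real_normed_vector \<Rightarrow> 'b::real_normed_vector) \<Rightarrow> bool" where
  "C_k 0 f \<longleftrightarrow> continuous_on UNIV f"
| "C_k (Suc k) f \<longleftrightarrow>
     (\<forall>x. f differentiable (at x)) \<and> (\<forall>v. C_k k (\<lambda>x. frechet_derivative f (at x) v))"

definition interpolated_velocity ::
  "real \<Rightarrow> real \<Rightarrow> (real \<Rightarrow> real) \<Rightarrow> real^3 \<Rightarrow> vector_grid_fun \<Rightarrow> real^3 \<Rightarrow> real^3" where
  "interpolated_velocity L h \<phi> u0 a X =
     u0 + (\<chi> i. \<Sum>j\<in>UNIV. \<Sum>k\<in>UNIV. levi_civita i j k *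
            (\<Sum>x \<in> edge_grid h j \<inter> periodic_box L.
               a j x * partial_deriv k (periodic_delta L h \<phi>) (x - X) * h^3))"

end

theory Submission
  imports Defs
begin

text \<open>
  Each partial derivative of the periodic delta function is of class $C^{k-1}$, and the interpolated
  velocity is a constant plus a linear combination of reflected translates of these partial
  derivatives. This gives the regularity, and periodicity is inherited from the lattice sum, which is
  invariant under a shift of its index (\<open>periodic_delta_shift\<close>).

  For the divergence, the point is that the velocity is, up to a constant, the curl of the vector potential
  $\sum_{x} a(x)\,\delta_h(x - X)\,h^3$, so its divergence vanishes for the same reason as that of any
  curl: the symbol $\epsilon_{ijk}$ is antisymmetric in $i$ and $k$ (\<open>levi_civita_contraction\<close>),
  while the second derivatives $\partial_i\partial_k\delta_h$ are symmetric
  (\<open>C_k_2_mixed_derivatives\<close>). This cancellation takes place for each grid point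
  separately.
\<close>

section \<open>Closure properties of the class of k times continuously differentiable functions\<close>

lemma C_k_const: "C_k n (\<lambda>x. c)"
  by (induction n arbitrary: c) auto

lemma C_k_add:
  assumes "C_k n f" "C_k n g"
  shows "C_k n (\<lambda>x. f x + g x)"
  using assms
proof (induction n arbitrary: f g)
  case 0
  then show ?case by (auto intro: continuous_intros)
next
  case (Suc n)
  have "((\<lambda>x. f x + g x) has_derivative
          (\<lambda>v. frechet_derivative f (at x) v + frechet_derivative g (at x) v)) (at x)" for x
    using Suc.prems by (intro has_derivative_add) (auto simp flip: frechet_derivative_works)
  note D = this
  have "frechet_derivative (\<lambda>x. f x + g x) (at x) v
          = frechet_derivative f (at x) v + frechet_derivative g (at x) v" for x v
    using frechet_derivative_at[OF D] by metis
  moreover have "(\<lambda>x. f x + g x) differentiable (at x)" for x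
    using D by (rule differentiableI)
  ultimately show ?case using Suc by simp
qed

lemma C_k_sum:
  assumes "\<And>i. i \<in> I \<Longrightarrow> C_k n (f i)"
  shows "C_k n (\<lambda>x. \<Sum>i\<in>I. f i x)"
  using assms by (induction I rule: infinite_finite_induct) (auto intro: C_k_const C_k_add)

lemma C_k_bounded_linear:
  assumes "bounded_linear T" "C_k n f"
  shows "C_k n (\<lambda>x. T (f x))"
  using assms(2)
proof (induction n arbitrary: f)
  case 0
  then show ?case
    using assms(1) by (auto intro: bounded_linear.continuous_on)
next
  case (Suc n)
  have D: "((\<lambda>x. T (f x)) has_derivative (\<lambda>v. T (frechet_derivative f (at x) v))) (at x)" for x
    using Suc.prems
    by (intro bounded_linear.has_derivative[OF assms(1)]) (auto simp flip: frechet_derivative_works)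
  have "frechet_derivative (\<lambda>x. T (f x)) (at x) v = T (frechet_derivative f (at x) v)" for x v
    using frechet_derivative_at[OF D] by metis
  moreover have "(\<lambda>x. T (f x)) differentiable (at x)" for x
    using D by (rule differentiableI)
  ultimately show ?case using Suc by simp
qed

lemma C_k_compose_affine:
  assumes "bounded_linear T" "C_k n f"
  shows "C_k n (\<lambda>x. f (c + T x))"
  using assms(2)
proof (induction n arbitrary: f)
  case 0
  then show ?case
    by (auto intro!: continuous_on_compose2[of UNIV f] continuous_intros
        bounded_linear.continuous_on[OF assms(1)])
next
  case (Suc n)
  have D: "((\<lambda>x. f (c + T x)) has_derivative
             (\<lambda>v. frechet_derivative f (at (c + T x)) (T v))) (at x)" for x
  proof (rule has_derivative_compose[where g = f])
    show "((\<lambda>x. c + T x) has_derivative T) (at x)"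
      using has_derivative_add[OF has_derivative_const bounded_linear_imp_has_derivative[OF assms(1)]]
      by simp
    show "(f has_derivative frechet_derivative f (at (c + T x))) (at (c + T x))"
      using Suc.prems by (simp flip: frechet_derivative_works)
  qed
  have "frechet_derivative (\<lambda>x. f (c + T x)) (at x) v
          = frechet_derivative f (at (c + T x)) (T v)" for x v
    using frechet_derivative_at[OF D] by metis
  moreover have "(\<lambda>x. f (c + T x)) differentiable (at x)" for x
    using D by (rule differentiableI)
  moreover have "C_k n (\<lambda>x. frechet_derivative f (at (c + T x)) (T v))" for v
    using Suc.prems by (intro Suc.IH) simp
  ultimately show ?case by simp
qed

lemma C_k_Suc_imp: "C_k (Suc n) f \<Longrightarrow> C_k n f"
proof (induction n arbitrary: f)
  case 0
  then show ?case
    by (auto simp: continuous_on_eq_continuous_at intro: differentiable_imp_continuous_within)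
next
  case (Suc n)
  then show ?case by (metis C_k.simps(2))
qed

lemma C_k_mono:
  assumes "m \<le> n" "C_k n f"
  shows "C_k m f"
  using assms by (induction n rule: dec_induct) (auto dest: C_k_Suc_imp simp del: C_k.simps)

section \<open>Symmetry of second derivatives\<close>

lemma DERIV_along_line:
  fixes f :: "'a::real_normed_vector \<Rightarrow> real"
  assumes "f differentiable (at (x + t *\<^sub>R v))"
  shows "((\<lambda>t. f (x + t *\<^sub>R v)) has_real_derivative
           frechet_derivative f (at (x + t *\<^sub>R v)) v) (at t)"
proof -
  let ?D = "frechet_derivative f (at (x + t *\<^sub>R v))"
  have f: "(f has_derivative ?D) (at (x + t *\<^sub>R v))"
    using assms by (simp flip: frechet_derivative_works)
  have "((\<lambda>t. x + t *\<^sub>R v) has_derivative (\<lambda>s. s *\<^sub>R v)) (at t)"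
    by (auto intro!: derivative_eq_intros)
  from has_derivative_compose[OF this f]
  have "((\<lambda>t. f (x + t *\<^sub>R v)) has_derivative (\<lambda>s. ?D (s *\<^sub>R v))) (at t)" .
  moreover have "(\<lambda>s. ?D (s *\<^sub>R v)) = (*) (?D v)"
    using has_derivative_linear[OF f] by (auto simp: linear_cmul mult.commute)
  ultimately show ?thesis
    by (simp add: has_field_derivative_def)
qed

text \<open>
  The mean value theorem applied in direction \<open>v\<close> to a difference in direction \<open>w\<close>, and then to
  the derivative itself in direction \<open>w\<close>. The left-hand side is symmetric in \<open>v\<close> and
  \<open>w\<close>, which is what makes the two orders of differentiation comparable.
\<close>

lemma second_difference_mean_value:
  fixes f :: "'a::real_normed_vector \<Rightarrow> real"
  assumes f: "\<And>x. f differentiable (at x)"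
    and fv: "\<And>x. (\<lambda>y. frechet_derivative f (at y) v) differentiable (at x)"
    and s: "0 < s"
  shows "\<exists>\<xi> \<eta>. 0 < \<xi> \<and> \<xi> < s \<and> 0 < \<eta> \<and> \<eta> < s \<and>
           f (x + s *\<^sub>R v + s *\<^sub>R w) - f (x + s *\<^sub>R v) - f (x + s *\<^sub>R w) + f x =
           s\<^sup>2 * frechet_derivative (\<lambda>y. frechet_derivative f (at y) v)
                  (at (x + \<xi> *\<^sub>R v + \<eta> *\<^sub>R w)) w"
proof -
  let ?fv = "\<lambda>y. frechet_derivative f (at y) v"
  define g where "g t = f ((x + s *\<^sub>R w) + t *\<^sub>R v) - f (x + t *\<^sub>R v)" for t
  have "(g has_real_derivative ?fv ((x + s *\<^sub>R w) + t *\<^sub>R v) - ?fv (x + t *\<^sub>R v)) (at t)" for t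
    unfolding g_def by (intro DERIV_diff DERIV_along_line f)
  from MVT2[OF s this] obtain \<xi> where \<xi>: "0 < \<xi>" "\<xi> < s"
    "g s - g 0 = (s - 0) * (?fv ((x + s *\<^sub>R w) + \<xi> *\<^sub>R v) - ?fv (x + \<xi> *\<^sub>R v))"
    by blast
  have "((\<lambda>t. ?fv ((x + \<xi> *\<^sub>R v) + t *\<^sub>R w)) has_real_derivative
          frechet_derivative ?fv (at ((x + \<xi> *\<^sub>R v) + t *\<^sub>R w)) w) (at t)" for t
    by (intro DERIV_along_line fv)
  from MVT2[OF s this] obtain \<eta> where \<eta>: "0 < \<eta>" "\<eta> < s"
    "?fv ((x + \<xi> *\<^sub>R v) + s *\<^sub>R w) - ?fv ((x + \<xi> *\<^sub>R v) + 0 *\<^sub>R w)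
       = (s - 0) * frechet_derivative ?fv (at ((x + \<xi> *\<^sub>R v) + \<eta> *\<^sub>R w)) w"
    by blast
  have "g s - g 0 = s\<^sup>2 * frechet_derivative ?fv (at ((x + \<xi> *\<^sub>R v) + \<eta> *\<^sub>R w)) w"
    using \<xi>(3) \<eta>(3) by (simp add: power2_eq_square add_ac)
  then have "f (x + s *\<^sub>R v + s *\<^sub>R w) - f (x + s *\<^sub>R v) - f (x + s *\<^sub>R w) + f x =
      s\<^sup>2 * frechet_derivative ?fv (at (x + \<xi> *\<^sub>R v + \<eta> *\<^sub>R w)) w"
    by (simp add: g_def algebra_simps)
  then show ?thesis
    using \<xi>(1,2) \<eta>(1,2) by blast
qed

text \<open>
  Schwarz's theorem: both iterated derivatives are limits, as the step tends to zero, of the same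
  second difference divided by the square of the step.
\<close>

lemma C_k_2_mixed_derivatives:
  fixes f :: "'a::real_normed_vector \<Rightarrow> real"
  assumes "C_k 2 f"
  shows "frechet_derivative (\<lambda>y. frechet_derivative f (at y) v) (at x) w =
         frechet_derivative (\<lambda>y. frechet_derivative f (at y) w) (at x) v"
proof -
  let ?D = "\<lambda>v w x. frechet_derivative (\<lambda>y. frechet_derivative f (at y) v) (at x) w"
  define q where
    "q s = (f (x + s *\<^sub>R v + s *\<^sub>R w) - f (x + s *\<^sub>R v) - f (x + s *\<^sub>R w) + f x) / s\<^sup>2" for s
  have f: "f differentiable (at x)" for x
    using assms by (simp add: numeral_2_eq_2)
  have fv: "(\<lambda>y. frechet_derivative f (at y) v) differentiable (at x)" for x v
    using assms by (simp add: numeral_2_eq_2)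
  have cont: "isCont (?D v w) x" for v w x
    using assms by (simp add: numeral_2_eq_2 continuous_on_eq_continuous_at)
  have lim: "(Q \<longlongrightarrow> ?D v w x) (at_right 0)"
    if Q: "\<And>s. Q s = (f (x + s *\<^sub>R v + s *\<^sub>R w) - f (x + s *\<^sub>R v) - f (x + s *\<^sub>R w) + f x) / s\<^sup>2"
    for Q v w
  proof -
    have "\<exists>\<xi> \<eta>. 0 < \<xi> \<and> \<xi> < s \<and> 0 < \<eta> \<and> \<eta> < s \<and>
            Q s = ?D v w (x + \<xi> *\<^sub>R v + \<eta> *\<^sub>R w)" if "0 < s" for s
      using second_difference_mean_value[OF f fv that, of x v w] that
      unfolding Q by (metis nonzero_mult_div_cancel_left less_numeral_extra(3) zero_less_power)
    then obtain \<xi> \<eta> where *: "\<And>s. 0 < s \<Longrightarrow> 0 < \<xi> s \<and> \<xi> s < s \<and> 0 < \<eta> s \<and> \<eta> s < s \<and>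
            Q s = ?D v w (x + \<xi> s *\<^sub>R v + \<eta> s *\<^sub>R w)"
      by metis
    have pos: "\<forall>\<^sub>F s in at_right 0. (0::real) < s"
      by (simp add: eventually_at_right_less)
    have \<xi>0: "(\<xi> \<longlongrightarrow> 0) (at_right 0)" and \<eta>0: "(\<eta> \<longlongrightarrow> 0) (at_right 0)"
      by (rule tendsto_sandwich[of "\<lambda>_. 0" _ _ "\<lambda>s. s"];
          auto intro!: eventually_mono[OF pos] dest: * simp: less_imp_le)+
    have "((\<lambda>s. x + \<xi> s *\<^sub>R v + \<eta> s *\<^sub>R w) \<longlongrightarrow> x + 0 *\<^sub>R v + 0 *\<^sub>R w) (at_right 0)"
      by (intro tendsto_intros \<xi>0 \<eta>0)
    then have "((\<lambda>s. ?D v w (x + \<xi> s *\<^sub>R v + \<eta> s *\<^sub>R w)) \<longlongrightarrow> ?D v w x) (at_right 0)"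
      using isCont_tendsto_compose[OF cont[of x v w]] by simp
    then show ?thesis
      by (rule Lim_transform_eventually) (auto intro!: eventually_mono[OF pos] simp: *)
  qed
  have "(q \<longlongrightarrow> ?D v w x) (at_right 0)" "(q \<longlongrightarrow> ?D w v x) (at_right 0)"
    by (rule lim; simp add: q_def add_ac diff_diff_eq)+
  then show ?thesis
    by (rule tendsto_unique[OF trivial_limit_at_right_real])
qed

section \<open>Partial derivatives and the periodic delta function\<close>

lemma partial_deriv_eq_frechet_derivative:
  assumes "f differentiable (at x)"
  shows "partial_deriv i f x = frechet_derivative f (at x) (axis i 1)"
  unfolding partial_deriv_def
  using DERIV_along_line[of f x 0 "axis i 1"] assms by (auto intro!: DERIV_imp_deriv)

text \<open>
  The lattice sum is reindexed by a translation of the lattice; an unconditional sum is unaffected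
  by this, whether or not it converges.
\<close>

lemma periodic_delta_shift:
  "periodic_delta L h \<phi> (x + L *\<^sub>R axis i 1) = periodic_delta L h \<phi> x"
proof -
  let ?p = "\<lambda>n :: int^3. n + axis i 1"
  let ?emb = "\<lambda>n :: int^3. (\<chi> j. of_int (n $ j)) :: real^3"
  have bij: "bij_betw ?p UNIV UNIV"
    by (rule bij_betwI[where g = "\<lambda>n. n - axis i 1"]) auto
  have "(x + L *\<^sub>R axis i 1) + L *\<^sub>R ?emb n = x + L *\<^sub>R ?emb (?p n)" for n
    by (auto simp: vec_eq_iff axis_def algebra_simps)
  then have "periodic_delta L h \<phi> (x + L *\<^sub>R axis i 1)
      = (\<Sum>\<^sub>\<infinity>n\<in>UNIV. delta h \<phi> (x + L *\<^sub>R ?emb (?p n)))"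
    unfolding periodic_delta_def by (intro infsum_cong) (rule arg_cong)
  also have "\<dots> = periodic_delta L h \<phi> x"
    unfolding periodic_delta_def
    by (rule infsum_reindex_bij_betw[OF bij, of "\<lambda>n. delta h \<phi> (x + L *\<^sub>R ?emb n)"])
  finally show ?thesis .
qed

lemma partial_deriv_periodic_delta_shift:
  "partial_deriv k (periodic_delta L h \<phi>) (x - L *\<^sub>R axis i 1) =
   partial_deriv k (periodic_delta L h \<phi>) x"
proof -
  have "periodic_delta L h \<phi> (x - L *\<^sub>R axis i 1 + v) = periodic_delta L h \<phi> (x + v)" for v
    using periodic_delta_shift[of L h \<phi> "x - L *\<^sub>R axis i 1 + v" i] by (simp add: algebra_simps)
  then show ?thesis
    by (simp add: partial_deriv_def)
qed

lemma levi_civita_contraction: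
  assumes "\<And>i j k. c i j k = c k j i"
  shows "(\<Sum>i\<in>UNIV. \<Sum>j\<in>UNIV. \<Sum>k\<in>UNIV. levi_civita i j k * c i j k) = 0"
  using assms[of 1 2 3] assms[of 1 3 2] assms[of 2 1 3]
  by (simp add: sum_3 levi_civita_def)

section \<open>The interpolated velocity field\<close>

lemma C_k_interpolated_velocity:
  assumes "C_k (Suc m) (periodic_delta L h \<phi>)"
  shows "C_k m (interpolated_velocity L h \<phi> u0 a)"
proof -
  let ?G = "periodic_delta L h \<phi>"
  define S where "S i X = (\<Sum>j\<in>UNIV. \<Sum>k\<in>UNIV. levi_civita i j k *
     (\<Sum>x \<in> edge_grid h j \<inter> periodic_box L. a j x * partial_deriv k ?G (x - X) * h^3))" for i X
  have P: "C_k m (partial_deriv k ?G)" for k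
  proof -
    have "partial_deriv k ?G = (\<lambda>x. frechet_derivative ?G (at x) (axis k 1))"
      using assms by (auto intro!: partial_deriv_eq_frechet_derivative)
    then show ?thesis
      using assms by simp
  qed
  have "C_k m (\<lambda>X. partial_deriv k ?G (x - X))" for k x
    using C_k_compose_affine[OF bounded_linear_minus[OF bounded_linear_ident] P[of k], where c = x] by simp
  then have "C_k m (S i)" for i
    unfolding S_def
    by (intro C_k_sum C_k_bounded_linear[OF bounded_linear_mult_right]
        C_k_bounded_linear[OF bounded_linear_mult_left])
  then have "C_k m (\<lambda>X. u0 + (\<Sum>i\<in>UNIV. S i X *\<^sub>R axis i 1))"
    by (intro C_k_add C_k_const C_k_sum C_k_bounded_linear[OF bounded_linear_scaleR_left])
  moreover have "interpolated_velocity L h \<phi> u0 a = (\<lambda>X. u0 + (\<Sum>i\<in>UNIV. S i X *\<^sub>R axis i 1))"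
    by (simp add: fun_eq_iff interpolated_velocity_def S_def vec_eq_iff axis_def sum_3 forall_3)
  ultimately show ?thesis
    by simp
qed

lemma divergence_interpolated_velocity:
  assumes "C_k 2 (periodic_delta L h \<phi>)"
  shows "divergence (interpolated_velocity L h \<phi> u0 a) X = 0"
proof -
  let ?G = "periodic_delta L h \<phi>"
  let ?Q = "\<lambda>k i x. frechet_derivative (\<lambda>y. frechet_derivative ?G (at y) (axis k 1)) (at x) (axis i 1)"
  define c where "c i j k = (\<Sum>x \<in> edge_grid h j \<inter> periodic_box L.
     a j x * - ?Q k i (x - X) * h^3)" for i j k
  have P: "partial_deriv k ?G = (\<lambda>x. frechet_derivative ?G (at x) (axis k 1))" for k
    using assms by (auto simp: numeral_2_eq_2 intro!: partial_deriv_eq_frechet_derivative)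
  have "((\<lambda>t. partial_deriv k ?G (x - (X + t *\<^sub>R axis i 1))) has_real_derivative
          - ?Q k i (x - X)) (at 0)" for i k x
  proof -
    have d: "partial_deriv k ?G differentiable (at y)" for y
      using assms by (simp add: P numeral_2_eq_2)
    have lin: "linear (frechet_derivative (partial_deriv k ?G) (at (x - X)))"
      using d by (rule linear_frechet_derivative)
    show ?thesis
      using DERIV_along_line[of "partial_deriv k ?G" "x - X" 0 "- axis i 1"] d
      by (simp add: linear_neg[OF lin] diff_diff_eq P[symmetric])
  qed
  note D = this
  have "((\<lambda>t. interpolated_velocity L h \<phi> u0 a (X + t *\<^sub>R axis i 1) $ i) has_real_derivative
          (\<Sum>j\<in>UNIV. \<Sum>k\<in>UNIV. levi_civita i j k * c i j k)) (at 0)" for i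
  proof -
    have "((\<lambda>t. u0 $ i + (\<Sum>j\<in>UNIV. \<Sum>k\<in>UNIV. levi_civita i j k *
            (\<Sum>x \<in> edge_grid h j \<inter> periodic_box L.
               a j x * partial_deriv k ?G (x - (X + t *\<^sub>R axis i 1)) * h^3))) has_real_derivative
          0 + (\<Sum>j\<in>UNIV. \<Sum>k\<in>UNIV. levi_civita i j k * c i j k)) (at 0)"
      unfolding c_def by (intro DERIV_add DERIV_const DERIV_sum DERIV_cmult DERIV_cmult_right D)
    then show ?thesis
      by (simp add: interpolated_velocity_def)
  qed
  then have "divergence (interpolated_velocity L h \<phi> u0 a) X =
      (\<Sum>i\<in>UNIV. \<Sum>j\<in>UNIV. \<Sum>k\<in>UNIV. levi_civita i j k * c i j k)"
    unfolding divergence_def partial_deriv_def by (intro sum.cong refl DERIV_imp_deriv)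
  also have "\<dots> = 0"
    using C_k_2_mixed_derivatives[OF assms]
    by (intro levi_civita_contraction) (simp add: c_def)
  finally show ?thesis .
qed

theorem mainTheorem1:
  fixes L h :: real and N k :: nat
    and \<phi> :: "real \<Rightarrow> real"
    and u a :: vector_grid_fun
    and u0 :: "real^3"
    and U :: "real^3 \<Rightarrow> real^3"
  assumes L_pos: "0 < L" and N_pos: "0 < N" and h_eq: "h = L / real N"
    and u_periodic: "\<And>\<alpha>. periodic_on L (face_grid h \<alpha>) (u \<alpha>)"
    and u_div_free: "\<And>x. x \<in> cell_grid h \<Longrightarrow> grid_div h u x = 0"
    and u0_eq: "u0 = face_mean L h u"
    and a_periodic: "\<And>\<alpha>. periodic_on L (edge_grid h \<alpha>) (a \<alpha>)"
    and curl_a: "\<And>\<alpha> x. x \<in> face_grid h \<alpha> \<Longrightarrow> grid_curl h a \<alpha> x = u \<alpha> x - u0 $ \<alpha>"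
    and div_a: "\<And>x. x \<in> node_grid h \<Longrightarrow> grid_div h a x = 0"
    and phi_supp: "compactly_supported \<phi>"
    and k_ge_1: "1 \<le> k"
    and delta_Ck: "C_k k (periodic_delta L h \<phi>)"
    and U_eq: "\<And>X. U X = interpolated_velocity L h \<phi> u0 a X"
  shows "periodic_on L UNIV U \<and> C_k (k - 1) U \<and>
         (2 \<le> k \<longrightarrow> (\<forall>X. divergence U X = 0))"
proof (intro conjI impI allI)
  have U: "U = interpolated_velocity L h \<phi> u0 a"
    using U_eq by blast
  show "periodic_on L UNIV U"
    by (simp add: periodic_on_def U interpolated_velocity_def diff_diff_eq[symmetric]
        partial_deriv_periodic_delta_shift)
  show "C_k (k - 1) U"
    unfolding U using delta_Ck k_ge_1 by (intro C_k_interpolated_velocity) simp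
  show "divergence U X = 0" if "2 \<le> k" for X
    unfolding U using C_k_mono[OF that delta_Ck] by (rule divergence_interpolated_velocity)
qed

end
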